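(* Let $a_1,b_1,a_2,b_2,T$ be integers with $0<a_1\le b_1$, $0<a_2\le b_2$ and $T\ge b_1+b_2$. Put $a=\max\{a_1,a_2\}$, $b'_u=\max\{b_u,a\}$ for $u\in\{1,2\}$, and $\alpha=T+1-b'_1-b'_2-a$. Suppose that $$\max\{b'_1,b'_2\}\ \big|\ \alpha\qquad\text{and}\qquad (a_1=a_2\ \text{ or }\ b_1=b_2).$$ Then the code given by the Construction described in the context is a rate-optimal $(a_1,b_1,a_2,b_2,T)$ streaming code. That is, it is an $(a_1,b_1,a_2,b_2,T)$ streaming code over the three-node decode-and-forward relay network, and its rate is $$\frac{k}{\max\{n_1,n_2\}}=\min\{\mathsf{C}_{a_1,b_1,T-b_2},\ \mathsf{C}_{a_2,b_2,T-b_1}\},$$ where $\mathsf{C}_{a,b,\tau}=\frac{\tau-a+1}{\tau-a+1+b}$.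
   Context: **DCSW channel.** For integers $0<a\le b\le \tau$, an $(a,b,\tau)$ delay-constrained sliding-window (DCSW) channel is a packet-erasure channel over time slots $0,1,2,\dots$ with decoding delay $\tau$ and window size $w=\tau+1$. A set $E\subseteq\mathbb{Z}_{\ge 0}$ of erased time slots is a permissible erasure pattern if, for every window $W$ of $w$ consecutive time slots, $E\cap W$ either has at most $a$ elements, or is a single burst, i.e. a set of consecutive time slots, of length at most $b$. The point-to-point channel capacity is $\mathsf{C}_{a,b,\tau}=\frac{\tau-a+1}{\tau-a+1+b}$. **Three-node decode-and-forward (D&F) relay network.** There is a source $s$, a relay $r$ and a destination $d$. The channel $(s,r)$ is an $(a_1,b_1,T_1)$ DCSW channel and the channel $(r,d)$ is an $(a_2,b_2,T_2)$ DCSW channel, with $T_1=T-b'_2$ and $T_2=T-b'_1$ (here $b'_u=\max\{b_u,a_1,a_2\}$). A packet-level code with parameters $(k,n_1,n_2)_{\mathbb{F}_q}$ works as follows. - At each time $i\ge 0$ the source has an arbitrary message packet $\boldsymbol{m}_i\in\mathbb{F}_q^k$ and transmits $\boldsymbol{x}_i=[\boldsymbol{m}_i^{\top},\boldsymbol{p}_i^{\top}]^{\top}\in\mathbb{F}_q^{n_1}$, where $\boldsymbol{p}_i\in\mathbb{F}_q^{n_1-k}$ is a function of $\boldsymbol{m}_0,\dots,\boldsymbol{m}_i$. The relay receives $\boldsymbol{y}^{(r)}_i$, equal to $\boldsymbol{x}_i$ if slot $i$ is not erased on $(s,r)$ and to the erasure symbol $*$ otherwise. - At the same time $i$ the relay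 transmits $\boldsymbol{x}^{(r)}_i\in\mathbb{F}_q^{n_2}$, computed from $\boldsymbol{y}^{(r)}_0,\dots,\boldsymbol{y}^{(r)}_i$. The relay encoding does not take into account the erasure pattern observed on $(s,r)$: for each $i$ there is a fixed function $g_i$ such that $\boldsymbol{x}^{(r)}_i=g_i(\boldsymbol{m}_0,\dots,\boldsymbol{m}_i)$ for every permissible erasure pattern of $(s,r)$. (So, for every permissible pattern, this value must be determined by $\boldsymbol{y}^{(r)}_0,\dots,\boldsymbol{y}^{(r)}_i$.) - The destination receives $\boldsymbol{y}_i$, equal to $\boldsymbol{x}^{(r)}_i$ if slot $i$ is not erased on $(r,d)$ and to $*$ otherwise. The code is an $(a_1,b_1,a_2,b_2,T)$ streaming code if, for every permissible erasure pattern of $(s,r)$ and every permissible erasure pattern of $(r,d)$, the destination can recover $\boldsymbol{m}_i$ from $\boldsymbol{y}_0,\dots,\boldsymbol{y}_{i+T}$, for every $i\ge 0$. Its rate is $\frac{k}{\max\{n_1,n_2\}}$. It is called rate-optimal if its rate equals $\min\{\mathsf{C}_{a_1,b_1,T-b_2},\mathsf{C}_{a_2,b_2,T-b_1}\}$. **Staggered diagonal embedding (SDE).** Let $\mathcal{C}$ be an $[n,k]$ linear code over $\mathbb{F}_q$ in systematic form (the first $k$ code symbols are the message symbols), and let $S=\{i_0<i_1<\dots<i_{n-1}\}\subseteq[0,N-1]$ with $i_0=0$, $i_{n-1}=N-1$ (the placement set and dispersion span). The SDE of $\mathcal{C}$ with placement set $S$ encodes a stream of message packets in $\mathbb{F}_q^k$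 (packets at negative times being zero) into the stream of coded packets $\boldsymbol{x}_i\in\mathbb{F}_q^{n}$ whose first $k$ symbols $\boldsymbol{x}_i(0),\dots,\boldsymbol{x}_i(k-1)$ are the symbols of the $i$-th message packet, and such that for every integer $i$ the vector $(\boldsymbol{x}_{i+i_0}(0),\boldsymbol{x}_{i+i_1}(1),\dots,\boldsymbol{x}_{i+i_{n-1}}(n-1))$ is a codeword of $\mathcal{C}$. **Construction.** Let $a=\max\{a_1,a_2\}$, $b'_u=\max\{b_u,a\}$, $\alpha=T+1-b'_1-b'_2-a$, and $$k=\left\lfloor a\cdot\frac{T-\min\{b'_1,b'_2\}-a+1}{\max\{b'_1,b'_2\}}\right\rfloor,\qquad n_1=n_2=k+a.$$ For $u\in\{1,2\}$ let $\mathcal{C}_u$ be any systematic $[k+a,k]$ MDS code over $\mathbb{F}_q$ ($q$ such that these exist), with dispersion span and placement set $$N_u=n_u+(b'_u-a)\left\lfloor\frac{n_u-1}{a}\right\rfloor,\qquad S_u=\left\{\,l+(b'_u-a)\left\lfloor\frac{l}{a}\right\rfloor : 0\le l\le n_u-1\right\}.$$ The source encodes $(\boldsymbol{m}_i)_{i\ge0}$ by SDE of $\mathcal{C}_1$ with placement set $S_1$, giving $\boldsymbol{x}_i\in\mathbb{F}_q^{n_1}$. For $0\le j\le k-1$ put $t_j=N_1-1-j-(b'_1-a)\lfloor j/a\rfloor$; the relay decodes symbol $\boldsymbol{m}_i(j)$ by time $i+t_j$. The relay forms, at each time $i$, a relay message packet $\boldsymbol{\mu}_i\in\mathbb{F}_q^k$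 in which the order of symbols is flipped, namely $\boldsymbol{\mu}_i(k-1-j)=\boldsymbol{m}_{i-t_j}(j)$ for $0\le j\le k-1$ (message packets at negative times being zero), and encodes the stream $(\boldsymbol{\mu}_i)$ by SDE of $\mathcal{C}_2$ with placement set $S_2$, giving the transmitted packets $\boldsymbol{x}^{(r)}_i\in\mathbb{F}_q^{n_2}$. The corresponding decoding delay of the $j$-th message symbol over $(r,d)$ is $\tau_j=N_2-1-(k-1-j)-(b'_2-a)\lfloor (k-1-j)/a\rfloor$. *)

theory Defs
  imports "Jordan_Normal_Form.VS_Connect"
begin

section \<open>Delay-constrained sliding-window channels\<close>

definition dcsw_parameters :: "nat \<Rightarrow> nat \<Rightarrow> nat \<Rightarrow> bool" where
  "dcsw_parameters a b \<tau> \<longleftrightarrow> 0 < a \<and> a \<le> b \<and> b \<le> \<tau>"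

text \<open>The windows \<open>{s..s + \<tau>}\<close> have \<open>\<tau> + 1\<close> time slots.\<close>

definition dcsw_patterns :: "nat \<Rightarrow> nat \<Rightarrow> nat \<Rightarrow> nat set set" where
  "dcsw_patterns a b \<tau> =
     {E. \<forall>s. card (E \<inter> {s..s + \<tau>}) \<le> a \<or>
             (\<exists>t l. l \<le> b \<and> E \<inter> {s..s + \<tau>} = {t..<t + l})}"

definition dcsw_capacity :: "real \<Rightarrow> real \<Rightarrow> real \<Rightarrow> real" where
  "dcsw_capacity a b \<tau> = (\<tau> - a + 1) / (\<tau> - a + 1 + b)"

definition erase :: "nat set \<Rightarrow> (nat \<Rightarrow> 'x) \<Rightarrow> nat \<Rightarrow> 'x option" where
  "erase E x i = (if i \<in> E then None else Some (x i))"


section \<open>Three-node decode-and-forward relay network\<close>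

definition message_streams :: "nat \<Rightarrow> (nat \<Rightarrow> 'f vec) set" where
  "message_streams k = {m. \<forall>i. m i \<in> carrier_vec k}"

text \<open>On inputs from \<open>X\<close>, the output at time \<open>i\<close> is a function of the inputs at
  times \<open>0, \<dots>, i + D\<close>.\<close>

definition delay_causal :: "(nat \<Rightarrow> 'x) set \<Rightarrow> nat \<Rightarrow> ((nat \<Rightarrow> 'x) \<Rightarrow> nat \<Rightarrow> 'y) \<Rightarrow> bool" where
  "delay_causal X D f \<longleftrightarrow>
     (\<forall>x\<in>X. \<forall>x'\<in>X. \<forall>i. (\<forall>j\<le>i + D. x j = x' j) \<longrightarrow> f x i = f x' i)"

text \<open>A packet-level code is given by a source encoder \<open>src\<close> (messages to source packets) and a
  relay encoder \<open>rel\<close> (packets received by the relay to relay packets).  The function \<open>g\<close> gives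
  the relay packets in terms of the messages; \<open>P\<close> is the set of permissible
  erasure patterns of the source-relay channel.\<close>

definition df_relay_code ::
  "nat set set \<Rightarrow> nat \<Rightarrow> nat \<Rightarrow> nat \<Rightarrow> ((nat \<Rightarrow> 'f vec) \<Rightarrow> nat \<Rightarrow> 'f vec) \<Rightarrow>
   ((nat \<Rightarrow> 'f vec option) \<Rightarrow> nat \<Rightarrow> 'f vec) \<Rightarrow> ((nat \<Rightarrow> 'f vec) \<Rightarrow> nat \<Rightarrow> 'f vec) \<Rightarrow> bool" where
  "df_relay_code P k n1 n2 src rel g \<longleftrightarrow>
     k \<le> n1 \<and>
     (\<forall>m\<in>message_streams k. \<forall>i. \<exists>p\<in>carrier_vec (n1 - k). src m i = m i @\<^sub>v p) \<and>
     delay_causal (message_streams k) 0 src \<and>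
     (\<forall>y i. rel y i \<in> carrier_vec n2) \<and>
     delay_causal UNIV 0 rel \<and>
     delay_causal (message_streams k) 0 g \<and>
     (\<forall>E\<in>P. \<forall>m\<in>message_streams k. \<forall>i. rel (erase E (src m)) i = g m i)"

definition streaming_code ::
  "nat \<Rightarrow> nat \<Rightarrow> nat \<Rightarrow> nat \<Rightarrow> nat \<Rightarrow> nat \<Rightarrow> nat \<Rightarrow> nat \<Rightarrow> ((nat \<Rightarrow> 'f vec) \<Rightarrow> nat \<Rightarrow> 'f vec) \<Rightarrow>
   ((nat \<Rightarrow> 'f vec option) \<Rightarrow> nat \<Rightarrow> 'f vec) \<Rightarrow> ((nat \<Rightarrow> 'f vec) \<Rightarrow> nat \<Rightarrow> 'f vec) \<Rightarrow> bool" where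
  "streaming_code a1 b1 a2 b2 T k n1 n2 src rel g \<longleftrightarrow>
     (let T1 = T - Max {b2, a1, a2};
          T2 = T - Max {b1, a1, a2};
          P1 = dcsw_patterns a1 b1 T1;
          P2 = dcsw_patterns a2 b2 T2
      in dcsw_parameters a1 b1 T1 \<and> dcsw_parameters a2 b2 T2 \<and>
         df_relay_code P1 k n1 n2 src rel g \<and>
         (\<exists>dec. delay_causal UNIV T dec \<and>
            (\<forall>E1\<in>P1. \<forall>E2\<in>P2. \<forall>m\<in>message_streams k. \<forall>i.
               dec (erase E2 (rel (erase E1 (src m)))) i = m i)))"


section \<open>Systematic MDS codes\<close>

definition linear_code :: "nat \<Rightarrow> nat \<Rightarrow> 'f::field vec set \<Rightarrow> bool" where
  "linear_code n k C \<longleftrightarrow>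
     VectorSpace.subspace class_ring C (module_vec TYPE('f) n) \<and>
     vectorspace.dim class_ring (module_vec TYPE('f) n \<lparr>carrier := C\<rparr>) = k"

definition systematic :: "nat \<Rightarrow> 'f vec set \<Rightarrow> bool" where
  "systematic k C \<longleftrightarrow> (\<forall>u\<in>carrier_vec k. \<exists>!c. c \<in> C \<and> vec_first c k = u)"

definition hamming_distance :: "'f vec \<Rightarrow> 'f vec \<Rightarrow> nat" where
  "hamming_distance v w = card {l. l < dim_vec v \<and> v $ l \<noteq> w $ l}"

definition minimum_distance :: "'f vec set \<Rightarrow> nat" where
  "minimum_distance C = Min {hamming_distance v w | v w. v \<in> C \<and> w \<in> C \<and> v \<noteq> w}"

definition systematic_mds_code :: "nat \<Rightarrow> nat \<Rightarrow> 'f::field vec set \<Rightarrow> bool" where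
  "systematic_mds_code n k C \<longleftrightarrow>
     linear_code n k C \<and> systematic k C \<and> minimum_distance C = n - k + 1"


section \<open>Staggered diagonal embedding\<close>

definition placement_set :: "nat \<Rightarrow> nat \<Rightarrow> nat set \<Rightarrow> bool" where
  "placement_set n N S \<longleftrightarrow> S \<subseteq> {..<N} \<and> card S = n \<and> 0 \<in> S \<and> N - 1 \<in> S"

text \<open>\<open>sorted_list_of_set S ! l\<close> is the element of \<open>S\<close> with exactly \<open>l\<close> smaller elements in \<open>S\<close>.\<close>

definition is_sde ::
  "'f vec set \<Rightarrow> nat \<Rightarrow> nat \<Rightarrow> nat set \<Rightarrow> (int \<Rightarrow> 'f vec) \<Rightarrow> (int \<Rightarrow> 'f vec) \<Rightarrow> bool" where
  "is_sde C n k S m x \<longleftrightarrow>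
     (\<forall>i. x i \<in> carrier_vec n) \<and>
     (\<forall>i. \<forall>j<k. x i $ j = m i $ j) \<and>
     (\<forall>i. vec n (\<lambda>l. x (i + int (sorted_list_of_set S ! l)) $ l) \<in> C)"

definition sde ::
  "'f vec set \<Rightarrow> nat \<Rightarrow> nat \<Rightarrow> nat set \<Rightarrow> (int \<Rightarrow> 'f vec) \<Rightarrow> int \<Rightarrow> 'f vec" where
  "sde C n k S m = (THE x. is_sde C n k S m x)"

lemma sde_well_defined:
  assumes C: "C \<subseteq> carrier_vec n" and sys: "systematic k C" and kn: "k \<le> n"
    and m: "\<And>i. m i \<in> carrier_vec k"
  shows "\<exists>!x. is_sde C n k S m x"
proof -
  define p where "p l = int (sorted_list_of_set S ! l)" for l
  define u where "u i = vec k (\<lambda>l. m (i + p l) $ l)" for i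
  define c where "c i = (THE c. c \<in> C \<and> vec_first c k = u i)" for i
  have u: "u i \<in> carrier_vec k" for i by (simp add: u_def)
  have ex1: "\<exists>!c. c \<in> C \<and> vec_first c k = u i" for i
    using sys u unfolding systematic_def by blast
  have c: "c i \<in> C" "vec_first (c i) k = u i" for i
    using theI'[OF ex1[of i]] unfolding c_def by auto
  have cdim: "c i \<in> carrier_vec n" for i using c(1) C by blast
  have clow: "c i $ l = m (i + p l) $ l" if "l < k" for i l
  proof -
    have "c i $ l = vec_first (c i) k $ l" using that by (simp add: vec_first_def)
    also have "\<dots> = m (i + p l) $ l" unfolding c(2) u_def using that by simp
    finally show ?thesis .
  qed
  define x where "x i = vec n (\<lambda>l. c (i - p l) $ l)" for i
  have diag: "vec n (\<lambda>l. x (i + p l) $ l) = c i" for i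
    using cdim[of i] by (intro eq_vecI) (auto simp: x_def)
  have "is_sde C n k S m x"
    unfolding is_sde_def
  proof (intro conjI allI impI)
    show "x i \<in> carrier_vec n" for i by (simp add: x_def)
    show "x i $ j = m i $ j" if "j < k" for i j
      using that kn clow[OF that, of "i - p j"] by (simp add: x_def)
    show "vec n (\<lambda>l. x (i + int (sorted_list_of_set S ! l)) $ l) \<in> C" for i
      using diag[of i] c(1)[of i] by (simp add: p_def)
  qed
  moreover have "y = x" if y: "is_sde C n k S m y" for y
  proof
    fix i
    have yc: "vec n (\<lambda>l. y (j + p l) $ l) = c j" for j
    proof -
      have "vec_first (vec n (\<lambda>l. y (j + p l) $ l)) k = u j"
        using y kn by (intro eq_vecI) (auto simp: is_sde_def u_def vec_first_def)
      moreover have "vec n (\<lambda>l. y (j + p l) $ l) \<in> C"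
        using y by (simp add: is_sde_def p_def)
      ultimately show ?thesis using ex1[of j] c[of j] by blast
    qed
    show "y i = x i"
    proof (rule eq_vecI)
      show "dim_vec (y i) = dim_vec (x i)" using y by (auto simp: is_sde_def x_def)
      fix l assume "l < dim_vec (x i)"
      then have l: "l < n" by (simp add: x_def)
      have "y i $ l = vec n (\<lambda>l'. y (i - p l + p l') $ l') $ l" using l by simp
      also have "\<dots> = x i $ l" unfolding yc using l by (simp add: x_def)
      finally show "y i $ l = x i $ l" .
    qed
  qed
  ultimately show ?thesis by blast
qed


section \<open>The relay construction\<close>

text \<open>In the following, \<open>b\<close> stands for \<open>b'\<^sub>u\<close>, so \<open>a \<le> b\<close> and the subtraction
  \<open>b - a\<close> does not truncate.\<close>

definition dispersion_span :: "nat \<Rightarrow> nat \<Rightarrow> nat \<Rightarrow> nat" where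
  "dispersion_span a b n = n + (b - a) * ((n - 1) div a)"

definition placement :: "nat \<Rightarrow> nat \<Rightarrow> nat \<Rightarrow> nat set" where
  "placement a b n = {l + (b - a) * (l div a) | l. l \<le> n - 1}"

lemma placement_set_placement:
  assumes "0 < n"
  shows "placement_set n (dispersion_span a b n) (placement a b n)"
proof -
  define f where "f l = l + (b - a) * (l div a)" for l
  have mono: "f l \<le> f l'" if "l \<le> l'" for l l'
    unfolding f_def using that by (intro add_mono mult_le_mono div_le_mono) auto
  have smono: "f l < f l'" if "l < l'" for l l'
    unfolding f_def using that by (intro add_less_le_mono mult_le_mono div_le_mono) auto
  have inj: "inj_on f {..n - 1}"
    by (intro linorder_inj_onI) (auto dest: smono)
  have eq: "placement a b n = f ` {..n - 1}"
    by (auto simp: placement_def f_def)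
  have N: "dispersion_span a b n = Suc (f (n - 1))"
    using assms by (simp add: dispersion_span_def f_def)
  have "f 0 = 0" by (simp add: f_def)
  then have "0 \<in> f ` {..n - 1}" by (metis atMost_iff image_eqI le0)
  then show ?thesis
    unfolding placement_set_def eq N using assms inj
    by (auto simp: card_image less_Suc_eq_le intro: mono)
qed

text \<open>\<open>symbol_delay a b n j\<close> is the time between transmission of the \<open>j\<close>-th message symbol and
  the end of the codeword containing it.\<close>

definition symbol_delay :: "nat \<Rightarrow> nat \<Rightarrow> nat \<Rightarrow> nat \<Rightarrow> int" where
  "symbol_delay a b n j =
     int (dispersion_span a b n) - 1 - int j - int ((b - a) * (j div a))"

definition zero_extend :: "nat \<Rightarrow> (nat \<Rightarrow> 'f::zero vec) \<Rightarrow> int \<Rightarrow> 'f vec" where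
  "zero_extend k m i = (if i < 0 then 0\<^sub>v k else m (nat i))"

definition source_encoder ::
  "'f::zero vec set \<Rightarrow> nat \<Rightarrow> nat \<Rightarrow> nat \<Rightarrow> nat \<Rightarrow> (nat \<Rightarrow> 'f vec) \<Rightarrow> nat \<Rightarrow> 'f vec" where
  "source_encoder C a b n k m i = sde C n k (placement a b n) (zero_extend k m) (int i)"

text \<open>Symbol \<open>l = k - 1 - j\<close> of the relay message at time \<open>i\<close> is symbol \<open>j\<close> of the
  source message at time \<open>i - t j\<close>.\<close>

definition relay_message ::
  "nat \<Rightarrow> (nat \<Rightarrow> int) \<Rightarrow> (nat \<Rightarrow> 'f::zero vec) \<Rightarrow> int \<Rightarrow> 'f vec" where
  "relay_message k t m i =
     vec k (\<lambda>l. let j = k - 1 - l in zero_extend k m (i - t j) $ j)"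

definition relay_packets ::
  "'f::zero vec set \<Rightarrow> nat \<Rightarrow> nat \<Rightarrow> nat \<Rightarrow> nat \<Rightarrow> (nat \<Rightarrow> int) \<Rightarrow> (nat \<Rightarrow> 'f vec) \<Rightarrow> nat \<Rightarrow> 'f vec" where
  "relay_packets C a b n k t m i = sde C n k (placement a b n) (relay_message k t m) (int i)"

end

theory Submission
  imports Defs
begin

text \<open>The hypotheses force \<open>b'\<^sub>u = b\<^sub>u\<close> and \<open>\<alpha> = c M\<close> with \<open>c \<ge> 0\<close> and
  \<open>M = max b\<^sub>1 b\<^sub>2\<close>, hence \<open>k = a (c + 1)\<close> and \<open>n = a (c + 2)\<close>. A codeword occupies blocks of \<open>a\<close>
  slots repeated with period \<open>b\<^sub>u\<close>, so a burst of length \<open>b\<^sub>u\<close> meets it in at most \<open>a\<close> slots, and its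
  span \<open>(c + 1) b\<^sub>u + a\<close> fits into one window. Every codeword thus suffers at most \<open>a\<close> erasures,
  which the minimum distance \<open>a + 1\<close> tolerates, and is determined when its last slot has passed.
  Thanks to the flipped order, symbol \<open>j = a q + r\<close> incurs the total delay
  \<open>b\<^sub>1 + b\<^sub>2 + a - 1 + (c - q) b\<^sub>1 + q b\<^sub>2 \<le> T\<close>.\<close>

section \<open>Placement of a codeword\<close>

text \<open>The increasing parametrization of \<open>placement\<close> by codeword index, so that
  positions can be computed without a sorted list.\<close>

definition place_pos :: "nat \<Rightarrow> nat \<Rightarrow> nat \<Rightarrow> nat" where
  "place_pos a b l = l + (b - a) * (l div a)"

lemma place_pos_less: "l < l' \<Longrightarrow> place_pos a b l < place_pos a b l'"
  unfolding place_pos_def by (intro add_less_le_mono mult_le_mono div_le_mono) auto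

lemma place_pos_mono: "l \<le> l' \<Longrightarrow> place_pos a b l \<le> place_pos a b l'"
  using place_pos_less[of l l' a b] by (cases "l = l'") auto

text \<open>Quotient and remainder by \<open>a\<close> become block number and place in the block:
  blocks of \<open>a\<close> consecutive slots start at the multiples of \<open>b\<close>.\<close>

lemma place_pos_eq:
  assumes "a \<le> b"
  shows "place_pos a b l = b * (l div a) + l mod a"
proof -
  have "l + (b - a) * (l div a) = (a * (l div a) + l mod a) + (b - a) * (l div a)" by simp
  also have "\<dots> = (a + (b - a)) * (l div a) + l mod a" by (simp only: algebra_simps)
  finally show ?thesis using assms by (simp add: place_pos_def)
qed

lemma nth_sorted_list_of_placement:
  assumes "l < n"
  shows "sorted_list_of_set (placement a b n) ! l = place_pos a b l"
proof -
  have "placement a b n = place_pos a b ` {..<n}"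
    using assms by (auto simp: placement_def place_pos_def image_iff)
  moreover have "sorted_list_of_set (place_pos a b ` {..<n}) = map (place_pos a b) [0..<n]"
  proof (rule sorted_distinct_set_unique)
    show "sorted (map (place_pos a b) [0..<n])"
      by (auto simp: sorted_iff_nth_mono intro: place_pos_mono)
    show "distinct (map (place_pos a b) [0..<n])"
      by (auto simp: distinct_map intro!: linorder_inj_onI dest: place_pos_less[of _ _ a b])
  qed (auto simp: atLeast0LessThan)
  ultimately show ?thesis using assms by simp
qed

lemma dispersion_span_eq: "0 < n \<Longrightarrow> dispersion_span a b n = Suc (place_pos a b (n - 1))"
  by (simp add: dispersion_span_def place_pos_def)

lemma symbol_delay_eq:
  "0 < n \<Longrightarrow> symbol_delay a b n l = int (place_pos a b (n - 1)) - int (place_pos a b l)"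
  by (simp add: symbol_delay_def dispersion_span_eq place_pos_def)

text \<open>Two indices with the same residue mod \<open>a\<close> but in different blocks lie at
  least \<open>b\<close> slots apart. An interval of length \<open>b\<close> therefore meets each
  residue class at most once.\<close>

lemma card_burst_le:
  assumes "0 < a" "a \<le> b"
  shows "card {l. l < n \<and> s + int (place_pos a b l) \<in> {t..<t + int b}} \<le> a"
proof -
  let ?L = "{l. l < n \<and> s + int (place_pos a b l) \<in> {t..<t + int b}}"
  have aux: "l div a = l' div a"
    if "l \<in> ?L" "l' \<in> ?L" "l mod a = l' mod a" "l div a \<le> l' div a" for l l'
  proof (rule ccontr)
    assume "l div a \<noteq> l' div a"
    with that have "l div a + 1 \<le> l' div a" by simp
    then have "b * (l div a + 1) \<le> b * (l' div a)" by (rule mult_le_mono2)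
    then have "place_pos a b l + b \<le> place_pos a b l'"
      using that(3) by (simp add: place_pos_eq[OF \<open>a \<le> b\<close>])
    with that(1,2) show False by auto
  qed
  have "inj_on (\<lambda>l. l mod a) ?L"
  proof (rule inj_onI)
    fix l l' assume l: "l \<in> ?L" "l' \<in> ?L" "l mod a = l' mod a"
    have "l div a = l' div a"
      using aux[OF l] aux[OF l(2) l(1) l(3)[symmetric]] by linarith
    with l(3) show "l = l'" by (metis div_mult_mod_eq)
  qed
  moreover have "(\<lambda>l. l mod a) ` ?L \<subseteq> {..<a}" using assms by auto
  ultimately show ?thesis using card_inj_on_le[of "\<lambda>l. l mod a" ?L "{..<a}"] by simp
qed

text \<open>The span bound puts all positions of one codeword into a single window, where the
  pattern has at most \<open>a0\<close> erasures or is one burst. The start \<open>s\<close> may be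
  negative, since the first codewords begin before time 0.\<close>

lemma card_erased_le:
  assumes "0 < a" "a \<le> b" "a0 \<le> a" and E: "E \<in> dcsw_patterns a0 b \<tau>"
    and n: "place_pos a b (n - 1) \<le> \<tau>"
  shows "card {l. l < n \<and> s + int (place_pos a b l) \<in> int ` E} \<le> a"
proof -
  let ?L = "{l. l < n \<and> s + int (place_pos a b l) \<in> int ` E}"
  \<comment> \<open>For negative \<open>s\<close> only slots from 0 on can be erased, and the window
    starting at \<open>nat s = 0\<close> still covers them.\<close>
  let ?W = "E \<inter> {nat s..nat s + \<tau>}"
  have L: "nat (s + int (place_pos a b l)) \<in> ?W \<and> 0 \<le> s + int (place_pos a b l)"
    if "l \<in> ?L" for l
  proof -
    have "place_pos a b l \<le> \<tau>" using that by (intro order_trans[OF place_pos_mono n]) auto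
    then show ?thesis using that by auto
  qed
  from E consider "card ?W \<le> a0" | t l0 where "l0 \<le> b" "?W = {t..<t + l0}"
    unfolding dcsw_patterns_def by blast
  then show ?thesis
  proof cases
    case 1
    have "inj_on (\<lambda>l. nat (s + int (place_pos a b l))) ?L"
    proof (intro linorder_inj_onI)
      fix l l' assume "l < l'" "l \<in> ?L" "l' \<in> ?L"
      then show "nat (s + int (place_pos a b l)) \<noteq> nat (s + int (place_pos a b l'))"
        using L[of l] L[of l'] place_pos_less[of l l' a b] by linarith
    qed auto
    moreover have "(\<lambda>l. nat (s + int (place_pos a b l))) ` ?L \<subseteq> ?W"
      using L by blast
    ultimately have "card ?L \<le> card ?W" by (rule card_inj_on_le) simp
    with 1 \<open>a0 \<le> a\<close> show ?thesis by simp
  next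
    case (2 t l0)
    have "?L \<subseteq> {l. l < n \<and> s + int (place_pos a b l) \<in> {int t..<int t + int b}}"
      using L 2 by fastforce
    then have "card ?L \<le> card {l. l < n \<and> s + int (place_pos a b l) \<in> {int t..<int t + int b}}"
      by (intro card_mono) auto
    also have "\<dots> \<le> a" using assms(1,2) by (rule card_burst_le)
    finally show ?thesis .
  qed
qed


section \<open>Staggered diagonal embedding\<close>

lemma mds_carrier: "systematic_mds_code n k C \<Longrightarrow> C \<subseteq> carrier_vec n"
  unfolding systematic_mds_code_def linear_code_def VectorSpace.subspace_def submodule_def
  by (auto simp: module_vec_simps)

lemma mds_eqI:
  assumes C: "systematic_mds_code n k C" and "v \<in> C" "w \<in> C"
    and d: "hamming_distance v w \<le> n - k"
  shows "v = w"
proof (rule ccontr)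
  assume "v \<noteq> w"
  let ?D = "{hamming_distance v w | v w. v \<in> C \<and> w \<in> C \<and> v \<noteq> w}"
  \<comment> \<open>\<open>Min\<close> is only informative on a finite set. The code may be infinite
    over a general field, so finiteness comes from bounding all distances by the length.\<close>
  have "hamming_distance v' w' \<le> n" if "v' \<in> C" for v' w'
  proof -
    have "dim_vec v' = n" using mds_carrier[OF C] that by auto
    then have "{l. l < dim_vec v' \<and> v' $ l \<noteq> w' $ l} \<subseteq> {..<n}" by auto
    then show ?thesis unfolding hamming_distance_def
      by (metis card_lessThan card_mono finite_lessThan)
  qed
  then have "?D \<subseteq> {..n}" by auto
  then have "finite ?D" by (rule finite_subset) simp
  moreover have "hamming_distance v w \<in> ?D" using \<open>v \<noteq> w\<close> assms(2,3) by blast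
  ultimately have "minimum_distance C \<le> hamming_distance v w"
    unfolding minimum_distance_def by (rule Min_le)
  with C d show False unfolding systematic_mds_code_def by simp
qed

lemma is_sde_sde:
  assumes "systematic_mds_code n k C" "k \<le> n" "\<And>i. m i \<in> carrier_vec k"
  shows "is_sde C n k S m (sde C n k S m)"
proof -
  have "systematic k C" using assms(1) by (simp add: systematic_mds_code_def)
  from sde_well_defined[OF mds_carrier[OF assms(1)] this assms(2,3)] show ?thesis
    unfolding sde_def by (rule theI')
qed

lemma is_sde_placement_codeword:
  assumes "is_sde C n k (placement a b n) m x"
  shows "vec n (\<lambda>l. x (i + int (place_pos a b l)) $ l) \<in> C"
proof -
  have "vec n (\<lambda>l. x (i + int (place_pos a b l)) $ l)
      = vec n (\<lambda>l. x (i + int (sorted_list_of_set (placement a b n) ! l)) $ l)"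
    by (intro eq_vecI) (simp_all add: nth_sorted_list_of_placement)
  then show ?thesis using assms unfolding is_sde_def by simp
qed

text \<open>Positions increase with the index, so a parity symbol is sent after all message symbols
  of its diagonal codeword, and these determine the codeword by systematicity.\<close>

lemma is_sde_causal:
  assumes sys: "systematic k C" and "k \<le> n"
    and x: "is_sde C n k (placement a b n) m x" and x': "is_sde C n k (placement a b n) m' x'"
    and eq: "\<And>s. s \<le> t \<Longrightarrow> m s = m' s"
  shows "x t = x' t"
proof (rule eq_vecI)
  show "dim_vec (x t) = dim_vec (x' t)"
    using x x' unfolding is_sde_def by (metis carrier_vecD)
  fix l assume "l < dim_vec (x' t)"
  then have l: "l < n" using x' unfolding is_sde_def by (metis carrier_vecD)
  show "x t $ l = x' t $ l"
  proof (cases "l < k")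
    case True
    then show ?thesis using x x' eq[of t] unfolding is_sde_def by simp
  next
    case False
    \<comment> \<open>Start of the diagonal whose symbol \<open>l\<close> is sent at time
      \<open>t\<close>.\<close>
    define s where "s = t - int (place_pos a b l)"
    define v where "v = vec n (\<lambda>l. x (s + int (place_pos a b l)) $ l)"
    define v' where "v' = vec n (\<lambda>l. x' (s + int (place_pos a b l)) $ l)"
    have "vec_first v k = vec_first v' k"
    proof (rule eq_vecI)
      fix j assume "j < dim_vec (vec_first v' k)"
      then have j: "j < k" by simp
      then have "place_pos a b j \<le> place_pos a b l" using False by (intro place_pos_mono) auto
      then have "m (s + int (place_pos a b j)) = m' (s + int (place_pos a b j))"
        by (intro eq) (simp add: s_def)
      then show "vec_first v k $ j = vec_first v' k $ j"
        using j \<open>k \<le> n\<close> x x' by (simp add: vec_first_def v_def v'_def is_sde_def)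
    qed simp
    moreover have "v \<in> C" "v' \<in> C"
      unfolding v_def v'_def using x x' by (auto intro: is_sde_placement_codeword)
    moreover have "vec_first v k \<in> carrier_vec k" by simp
    ultimately have "v = v'" using sys unfolding systematic_def by metis
    then have "v $ l = v' $ l" by simp
    then show ?thesis using l by (simp add: v_def v'_def s_def)
  qed
qed

text \<open>Symbols at negative times are not transmitted, but they are common to both streams by
  causality.\<close>

lemma is_sde_decode:
  assumes C: "systematic_mds_code n k C" and n: "n = k + a"
    and ab: "0 < a" "a \<le> b" "a0 \<le> a"
    and E: "E \<in> dcsw_patterns a0 b \<tau>" and \<tau>: "place_pos a b (n - 1) \<le> \<tau>"
    and x: "is_sde C n k (placement a b n) m x" and x': "is_sde C n k (placement a b n) m' x'"
    and neg: "\<And>s. s < 0 \<Longrightarrow> m s = m' s"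
    and eq: "\<And>j. int j \<le> e \<Longrightarrow> j \<notin> E \<Longrightarrow> x (int j) = x' (int j)"
    and l: "l < n" and e: "t + symbol_delay a b n l \<le> e"
  shows "x t $ l = x' t $ l"
proof -
  define s where "s = t - int (place_pos a b l)"
  define v where "v = vec n (\<lambda>l. x (s + int (place_pos a b l)) $ l)"
  define v' where "v' = vec n (\<lambda>l. x' (s + int (place_pos a b l)) $ l)"
  have sys: "systematic k C" using C by (simp add: systematic_mds_code_def)
  have agree: "x (s + int (place_pos a b j)) = x' (s + int (place_pos a b j))"
    if "j < n" "s + int (place_pos a b j) \<notin> int ` E" for j
  proof (cases "s + int (place_pos a b j) < 0")
    case True
    then show ?thesis
      using n by (intro is_sde_causal[OF sys _ x x'] neg) auto
  next
    case False
    then obtain i where i: "s + int (place_pos a b j) = int i" by (metis int_eq_iff linorder_not_le)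
    \<comment> \<open>\<open>symbol_delay\<close> runs to the last slot of the codeword, so the
      bound \<open>e\<close> covers all its positions.\<close>
    have "place_pos a b j \<le> place_pos a b (n - 1)" using that by (intro place_pos_mono) auto
    then have "int i \<le> e" using e l i by (simp add: s_def symbol_delay_eq)
    moreover have "i \<notin> E" using that i by auto
    ultimately show ?thesis unfolding i by (rule eq)
  qed
  \<comment> \<open>Both diagonals are codewords that differ in erased slots only, hence in at most
    \<open>a = n - k\<close> places.\<close>
  have "hamming_distance v v' \<le> card {l. l < n \<and> s + int (place_pos a b l) \<in> int ` E}"
    unfolding hamming_distance_def using agree
    by (intro card_mono subsetI) (auto simp: v_def v'_def, metis)
  also have "\<dots> \<le> a" using ab E \<tau> by (rule card_erased_le)
  finally have "v = v'"
    unfolding v_def v'_def using C x x' n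
    by (intro mds_eqI[OF C] is_sde_placement_codeword) auto
  then have "v $ l = v' $ l" by simp
  then show ?thesis using l by (simp add: v_def v'_def s_def)
qed


section \<open>The relay construction\<close>

text \<open>Turns uniqueness into an actual causal map: pick any message compatible with what was
  received so far. It yields the relay encoder (\<open>D = 0\<close>) and the destination decoder
  (\<open>D = T\<close>). The set \<open>Z\<close> and default \<open>z\<close> keep the output
  well-formed on inputs that no message can produce.\<close>

lemma causal_decoder_exists:
  fixes f :: "'m \<Rightarrow> nat \<Rightarrow> 'x" and val :: "'m \<Rightarrow> nat \<Rightarrow> 'z"
  assumes det: "\<And>E E' m m' i. E \<in> P \<Longrightarrow> m \<in> M \<Longrightarrow> m' \<in> M \<Longrightarrow>
      \<forall>j\<le>i + D. erase E (f m) j = erase E' (f m') j \<Longrightarrow> val m i = val m' i"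
    and range: "\<And>m i. m \<in> M \<Longrightarrow> val m i \<in> Z" and z: "z \<in> Z"
  obtains dec where "delay_causal UNIV D dec" "\<And>y i. dec y i \<in> Z"
    "\<And>E m. E \<in> P \<Longrightarrow> m \<in> M \<Longrightarrow> dec (erase E (f m)) = val m"
proof -
  \<comment> \<open>\<open>Q y i m\<close>: some pattern in \<open>P\<close> lets \<open>m\<close>
    explain \<open>y\<close> up to time \<open>i + D\<close>. Only this prefix of \<open>y\<close>
    enters, which gives causality.\<close>
  define Q where "Q y i m \<longleftrightarrow> m \<in> M \<and> (\<exists>E\<in>P. \<forall>j\<le>i + D. y j = erase E (f m) j)"
    for y :: "nat \<Rightarrow> 'x option" and i m
  define dec where "dec y i = (if \<exists>m. Q y i m then val (SOME m. Q y i m) i else z)"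
    for y :: "nat \<Rightarrow> 'x option" and i
  have Q: "Q y i (SOME m. Q y i m)" if "\<exists>m. Q y i m" for y :: "nat \<Rightarrow> 'x option" and i
    using that by (rule someI_ex)
  show thesis
  proof
    show "delay_causal UNIV D dec"
      unfolding delay_causal_def
    proof (intro ballI allI impI)
      fix y y' :: "nat \<Rightarrow> 'x option" and i assume "\<forall>j\<le>i + D. y j = y' j"
      then have "Q y i = Q y' i" unfolding Q_def by auto
      then show "dec y i = dec y' i" by (simp only: dec_def)
    qed
    show "dec y i \<in> Z" for y :: "nat \<Rightarrow> 'x option" and i
    proof (cases "\<exists>m. Q y i m")
      case True
      with Q[OF True] show ?thesis by (simp add: dec_def range Q_def[of y i "SOME m. Q y i m"])
    qed (simp add: dec_def z)
    show "dec (erase E (f m)) = val m" if E: "E \<in> P" and m: "m \<in> M" for E m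
    proof
      fix i
      have ex: "\<exists>m'. Q (erase E (f m)) i m'" using E m unfolding Q_def by blast
      define m' where "m' = (SOME m'. Q (erase E (f m)) i m')"
      have "Q (erase E (f m)) i m'" unfolding m'_def using ex by (rule Q)
      then obtain E' where "m' \<in> M" "\<forall>j\<le>i + D. erase E (f m) j = erase E' (f m') j"
        unfolding Q_def by blast
      then have "val m i = val m' i" using E m by (intro det)
      with ex show "dec (erase E (f m)) i = val m i" by (simp add: dec_def m'_def)
    qed
  qed
qed

lemma delay_causalD:
  assumes "delay_causal X D f" "x \<in> X" "x' \<in> X" "\<And>j. j \<le> i + D \<Longrightarrow> x j = x' j"
  shows "f x i = f x' i"
  using assms unfolding delay_causal_def by blast

lemma erase_eqD:
  assumes "erase E x j = erase E' x' j" "j \<notin> E"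
  shows "x j = x' j"
  using assms by (auto simp: erase_def split: if_splits)

lemma zero_extend_carrier: "m \<in> message_streams k \<Longrightarrow> zero_extend k m i \<in> carrier_vec k"
  by (auto simp: zero_extend_def message_streams_def)

lemma relay_message_carrier: "relay_message k t m i \<in> carrier_vec k"
  by (simp add: relay_message_def)

lemma empty_dcsw_pattern: "{} \<in> dcsw_patterns a b \<tau>"
  by (simp add: dcsw_patterns_def)

section \<open>Source encoder: systematic form and causality\<close>

lemma source_encoder_systematic:
  assumes C: "systematic_mds_code n k C" and "k \<le> n" and m: "m \<in> message_streams k"
  shows "\<exists>p\<in>carrier_vec (n - k). source_encoder C a b n k m i = m i @\<^sub>v p"
proof -
  define v where "v = source_encoder C a b n k m i"
  have x: "is_sde C n k (placement a b n) (zero_extend k m)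
             (sde C n k (placement a b n) (zero_extend k m))"
    using C \<open>k \<le> n\<close> zero_extend_carrier[OF m] by (rule is_sde_sde)
  then have v: "v \<in> carrier_vec n" "\<And>j. j < k \<Longrightarrow> v $ j = m i $ j"
    by (auto simp: v_def source_encoder_def is_sde_def zero_extend_def)
  have mi: "m i \<in> carrier_vec k" using m by (simp add: message_streams_def)
  have "v = m i @\<^sub>v vec (n - k) (\<lambda>l. v $ (k + l))"
    using v mi \<open>k \<le> n\<close> by (intro eq_vecI) (auto simp: not_less)
  then show ?thesis unfolding v_def by (intro bexI) auto
qed

lemma source_encoder_causal:
  assumes C: "systematic_mds_code n k C" and "k \<le> n"
  shows "delay_causal (message_streams k) 0 (source_encoder C a b n k)"
  unfolding delay_causal_def
proof (intro ballI allI impI)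
  fix m m' :: "nat \<Rightarrow> 'a vec" and i
  assume m: "m \<in> message_streams k" "m' \<in> message_streams k"
    and eq: "\<forall>j\<le>i + 0. m j = m' j"
  show "source_encoder C a b n k m i = source_encoder C a b n k m' i"
    unfolding source_encoder_def
  proof (rule is_sde_causal)
    show "systematic k C" using C by (simp add: systematic_mds_code_def)
    show "zero_extend k m s = zero_extend k m' s" if "s \<le> int i" for s
      using that eq by (simp add: zero_extend_def)
  qed (use C \<open>k \<le> n\<close> zero_extend_carrier m in \<open>auto intro: is_sde_sde\<close>)
qed

text \<open>The relay message at time \<open>s\<close> uses symbol \<open>j\<close> of time
  \<open>s - symbol_delay a b1 n j\<close>, which the first code has just made decodable at
  \<open>s\<close>. Causality of the second embedding carries this over to the packets.\<close>

lemma relay_packets_determined: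
  assumes C1: "systematic_mds_code n k C1" and C2: "systematic_mds_code n k C2"
    and n: "n = k + a" and ab: "0 < a" "a \<le> b1" "a1 \<le> a"
    and E: "E \<in> dcsw_patterns a1 b1 \<tau>" and \<tau>: "place_pos a b1 (n - 1) \<le> \<tau>"
    and m: "m \<in> message_streams k" "m' \<in> message_streams k"
    and view: "\<forall>j\<le>i. erase E (source_encoder C1 a b1 n k m) j
                     = erase E' (source_encoder C1 a b1 n k m') j"
  shows "relay_packets C2 a b2 n k (symbol_delay a b1 n) m i
       = relay_packets C2 a b2 n k (symbol_delay a b1 n) m' i"
proof -
  let ?S = "placement a b1 n"
  let ?x = "sde C1 n k ?S (zero_extend k m)" and ?x' = "sde C1 n k ?S (zero_extend k m')"
  have kn: "k \<le> n" using n by simp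
  have x: "is_sde C1 n k ?S (zero_extend k m) ?x" "is_sde C1 n k ?S (zero_extend k m') ?x'"
    using C1 kn m by (auto intro: is_sde_sde zero_extend_carrier)
  have sym: "zero_extend k m t $ j = zero_extend k m' t $ j"
    if j: "j < k" and t: "t + symbol_delay a b1 n j \<le> int i" for t j
  proof -
    have "?x t $ j = ?x' t $ j"
    proof (rule is_sde_decode[OF C1 n ab E \<tau> x])
      show "?x (int j') = ?x' (int j')" if "int j' \<le> int i" "j' \<notin> E" for j'
        using that erase_eqD[of E "source_encoder C1 a b1 n k m" j' E'] view
        by (simp add: source_encoder_def)
    qed (use j t kn in \<open>auto simp: zero_extend_def\<close>)
    then show ?thesis using x j by (simp add: is_sde_def)
  qed
  show ?thesis
    unfolding relay_packets_def
  proof (rule is_sde_causal)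
    show "systematic k C2" using C2 by (simp add: systematic_mds_code_def)
    show "relay_message k (symbol_delay a b1 n) m s = relay_message k (symbol_delay a b1 n) m' s"
      if "s \<le> int i" for s
      unfolding relay_message_def Let_def using that by (intro eq_vecI) (auto intro!: sym)
  qed (use C2 kn in \<open>auto intro: is_sde_sde relay_message_carrier\<close>)
qed

text \<open>Symbol \<open>j\<close> of \<open>m i\<close> is symbol \<open>k - 1 - j\<close> of the
  relay packet at time \<open>i + d j\<close>; its codeword over the second channel ends by time
  \<open>i + T\<close>.\<close>

lemma destination_determined:
  assumes C2: "systematic_mds_code n k C2"
    and n: "n = k + a" and ab: "0 < a" "a \<le> b2" "a2 \<le> a"
    and E: "E \<in> dcsw_patterns a2 b2 \<tau>" and \<tau>: "place_pos a b2 (n - 1) \<le> \<tau>"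
    and d: "\<And>j. j < k \<Longrightarrow> 0 \<le> d j"
    and T: "\<And>j. j < k \<Longrightarrow> d j + symbol_delay a b2 n (k - 1 - j) \<le> int T"
    and m: "m \<in> message_streams k" "m' \<in> message_streams k"
    and view: "\<forall>j\<le>i + T. erase E (relay_packets C2 a b2 n k d m) j
                         = erase E' (relay_packets C2 a b2 n k d m') j"
  shows "m i = m' i"
proof (rule eq_vecI)
  let ?S = "placement a b2 n"
  let ?x = "sde C2 n k ?S (relay_message k d m)" and ?x' = "sde C2 n k ?S (relay_message k d m')"
  have kn: "k \<le> n" using n by simp
  have x: "is_sde C2 n k ?S (relay_message k d m) ?x" "is_sde C2 n k ?S (relay_message k d m') ?x'"
    using C2 kn by (auto intro: is_sde_sde relay_message_carrier)
  have dim: "dim_vec (m i) = k" "dim_vec (m' i) = k"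
    using m by (auto simp: message_streams_def)
  then show "dim_vec (m i) = dim_vec (m' i)" by simp
  fix j assume "j < dim_vec (m' i)"
  then have j: "j < k" using dim by simp
  let ?l = "k - 1 - j"
  have l: "?l < k" "k - 1 - ?l = j" using j by auto
  have "?x (int i + d j) $ ?l = ?x' (int i + d j) $ ?l"
  proof (rule is_sde_decode[OF C2 n ab E \<tau> x])
    show "?x (int j') = ?x' (int j')" if "int j' \<le> int (i + T)" "j' \<notin> E" for j'
      using that erase_eqD[of E "relay_packets C2 a b2 n k d m" j' E'] view
      by (simp add: relay_packets_def)
    \<comment> \<open>Since \<open>d\<close> is nonnegative, a negative relay time reads a negative
      message time, where both streams are zero.\<close>
    show "relay_message k d m s = relay_message k d m' s" if "s < 0" for s
      unfolding relay_message_def Let_def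
    proof (intro eq_vecI; simp)
      fix l assume "l < k"
      then have "0 \<le> d (k - Suc l)" by (intro d) auto
      with that have "s - d (k - Suc l) < 0" by simp
      then show "zero_extend k m (s - d (k - Suc l)) $ (k - Suc l)
               = zero_extend k m' (s - d (k - Suc l)) $ (k - Suc l)"
        by (simp add: zero_extend_def)
    qed
    show "int i + d j + symbol_delay a b2 n ?l \<le> int (i + T)" using T[OF j] by simp
    show "?l < n" using l kn by simp
  qed
  then have "relay_message k d m (int i + d j) $ ?l = relay_message k d m' (int i + d j) $ ?l"
    using x l by (simp add: is_sde_def)
  then show "m i $ j = m' i $ j"
    using l by (simp add: relay_message_def zero_extend_def)
qed

text \<open>Reduces the streaming property to two span bounds and one bound on the summed delays.
  The hypotheses already take \<open>b1\<close>, \<open>b2\<close> at least \<open>a\<close>, so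
  they stand for the primed burst lengths.\<close>

lemma streaming_code_construction:
  assumes C1: "systematic_mds_code n k C1" and C2: "systematic_mds_code n k C2"
    and n: "n = k + a" and a: "0 < a1" "0 < a2" "a = max a1 a2" "a \<le> b1" "a \<le> b2"
    and T: "b1 + b2 \<le> T"
    and span: "place_pos a b1 (n - 1) \<le> T - b2" "place_pos a b2 (n - 1) \<le> T - b1"
    and delay: "\<And>j. j < k \<Longrightarrow> symbol_delay a b1 n j + symbol_delay a b2 n (k - 1 - j) \<le> int T"
  shows "\<exists>rel. streaming_code a1 b1 a2 b2 T k n n (source_encoder C1 a b1 n k) rel
                 (relay_packets C2 a b2 n k (symbol_delay a b1 n))"
proof -
  let ?src = "source_encoder C1 a b1 n k"
  let ?g = "relay_packets C2 a b2 n k (symbol_delay a b1 n)"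
  let ?P1 = "dcsw_patterns a1 b1 (T - b2)" and ?P2 = "dcsw_patterns a2 b2 (T - b1)"
  let ?M = "message_streams k :: (nat \<Rightarrow> 'a vec) set"
  have kn: "k \<le> n" and a_pos: "0 < a" and a12: "a1 \<le> a" "a2 \<le> a" using n a by auto
  have g_carrier: "?g m i \<in> carrier_vec n" for m i
    using is_sde_sde[OF C2 kn relay_message_carrier]
    by (simp add: relay_packets_def is_sde_def)
  obtain rel where rel: "delay_causal UNIV 0 rel" "\<And>y i. rel y i \<in> carrier_vec n"
    and rel_g: "\<And>E m. E \<in> ?P1 \<Longrightarrow> m \<in> ?M \<Longrightarrow> rel (erase E (?src m)) = ?g m"
  proof (rule causal_decoder_exists[where P = ?P1 and M = ?M and D = 0 and f = ?src
        and val = ?g and Z = "carrier_vec n" and z = "0\<^sub>v n"])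
    fix E E' m m' i
    assume E: "E \<in> ?P1" and m: "m \<in> ?M" "m' \<in> ?M"
      and view: "\<forall>j\<le>i + 0. erase E (?src m) j = erase E' (?src m') j"
    show "?g m i = ?g m' i"
      by (rule relay_packets_determined[OF C1 C2 n a_pos a(4) a12(1) E span(1) m
            view[unfolded add_0_right]])
  next
    show "?g m i \<in> carrier_vec n" for m i by (rule g_carrier)
  qed auto
  have src: "delay_causal ?M 0 ?src" using C1 kn by (rule source_encoder_causal)
  \<comment> \<open>Causality is inherited from \<open>rel\<close> and the source encoder by running
    them without erasures.\<close>
  have g: "delay_causal ?M 0 ?g"
    unfolding delay_causal_def
  proof (intro ballI allI impI)
    fix m m' i assume m: "m \<in> ?M" "m' \<in> ?M" and eq: "\<forall>j\<le>i + 0. m j = m' j"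
    have "erase {} (?src m) j = erase {} (?src m') j" if "j \<le> i" for j
      using delay_causalD[OF src m, of j] eq that by (simp add: erase_def)
    then have "rel (erase {} (?src m)) i = rel (erase {} (?src m')) i"
      by (intro delay_causalD[OF rel(1)]) auto
    then show "?g m i = ?g m' i" using m by (simp add: rel_g empty_dcsw_pattern)
  qed
  have d_nonneg: "0 \<le> symbol_delay a b1 n j" if "j < k" for j
    using that n place_pos_mono[of j "n - 1" a b1] by (simp add: symbol_delay_eq)
  obtain dec where dec: "delay_causal UNIV T dec"
    "\<And>E m. E \<in> ?P2 \<Longrightarrow> m \<in> ?M \<Longrightarrow> dec (erase E (?g m)) = m"
  proof (rule causal_decoder_exists[where P = ?P2 and M = ?M and D = T and f = ?g
        and val = "\<lambda>m. m" and Z = UNIV and z = undefined])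
    fix E E' m m' i
    assume E: "E \<in> ?P2" and m: "m \<in> ?M" "m' \<in> ?M"
      and view: "\<forall>j\<le>i + T. erase E (?g m) j = erase E' (?g m') j"
    show "m i = m' i"
      by (rule destination_determined[OF C2 n a_pos a(5) a12(2) E span(2) d_nonneg delay m view])
  qed auto
  have "Max {b2, a1, a2} = b2" "Max {b1, a1, a2} = b1" using a by auto
  moreover have "dcsw_parameters a1 b1 (T - b2)" "dcsw_parameters a2 b2 (T - b1)"
    using a T by (auto simp: dcsw_parameters_def)
  moreover have "df_relay_code ?P1 k n n ?src rel ?g"
    unfolding df_relay_code_def
  proof (intro conjI ballI allI)
    show "\<exists>p\<in>carrier_vec (n - k). ?src m i = m i @\<^sub>v p" if "m \<in> ?M" for m i
      using C1 kn that by (rule source_encoder_systematic)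
    show "rel (erase E (?src m)) i = ?g m i" if "E \<in> ?P1" "m \<in> ?M" for E m i
      using that by (simp only: rel_g)
  qed (fact kn src rel g)+
  moreover have "\<exists>dec. delay_causal UNIV T dec \<and> (\<forall>E1\<in>?P1. \<forall>E2\<in>?P2. \<forall>m\<in>?M. \<forall>i.
      dec (erase E2 (rel (erase E1 (?src m)))) i = m i)"
    using dec rel_g by (intro exI[of _ dec]) simp
  ultimately have "streaming_code a1 b1 a2 b2 T k n n ?src rel ?g"
    unfolding streaming_code_def Let_def by simp
  then show ?thesis by blast
qed

section \<open>Arithmetic of span, delay and rate\<close>

text \<open>Here \<open>c\<close> is the quotient \<open>\<alpha> div M\<close>, so \<open>k = a (c + 1)\<close>.\<close>

lemma place_pos_last:
  assumes "0 < a" "a \<le> b" "n = a * (c + 2)"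
  shows "place_pos a b (n - 1) = b * (c + 1) + (a - 1)"
proof -
  have n: "n - 1 = (a - 1) + a * (c + 1)" using assms by (simp add: algebra_simps)
  have "(n - 1) div a = c + 1" "(n - 1) mod a = a - 1"
    unfolding n using assms(1) by (simp_all only: div_mult_self2 mod_mult_self2 div_less mod_less)
  then show ?thesis using assms(2) by (simp add: place_pos_eq)
qed

text \<open>Flipping sends block \<open>q\<close> to block \<open>p = c - q\<close>, so a symbol
  that waits long at the relay waits little afterwards. The variable part of the delay is
  \<open>b1 * p + b2 * q\<close>, at most \<open>c * max b1 b2\<close> because
  \<open>p + q = c\<close>.\<close>

lemma total_delay_le:
  assumes a: "0 < a" "a \<le> b1" "a \<le> b2" and k: "k = a * (c + 1)" and n: "n = k + a"
    and T: "T + 1 = b1 + b2 + a + c * max b1 b2" and j: "j < k"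
  shows "symbol_delay a b1 n j + symbol_delay a b2 n (k - 1 - j) \<le> int T"
proof -
  define q r where "q = j div a" and "r = j mod a"
  have j_eq: "j = a * q + r" and r: "r < a" using a by (auto simp: q_def r_def)
  have "q < c + 1" unfolding q_def using j k by (simp add: less_mult_imp_div_less mult.commute)
  then obtain p where c: "c = q + p" using le_Suc_ex[of q c] by auto
  have "k = j + 1 + (a * p + (a - 1 - r))"
    using r unfolding k c j_eq by (simp add: algebra_simps)
  then have flip: "k - 1 - j = a * p + (a - 1 - r)" by simp
  have p1: "place_pos a b1 j = b1 * q + r"
    using a by (simp add: place_pos_eq q_def r_def)
  have p2: "place_pos a b2 (k - 1 - j) = b2 * p + (a - 1 - r)"
  proof -
    have "(k - 1 - j) div a = p" "(k - 1 - j) mod a = a - 1 - r"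
      unfolding flip using r by (simp_all only: div_mult_self4 mod_mult_self4 div_less mod_less)
    then show ?thesis using a by (simp add: place_pos_eq)
  qed
  have n': "n = a * (c + 2)" using k n by simp
  have "b1 * p + b2 * q \<le> max b1 b2 * p + max b1 b2 * q"
    by (intro add_mono mult_le_mono1) auto
  then have "b1 * p + b2 * q \<le> c * max b1 b2" by (simp add: c algebra_simps)
  moreover have "b1 * (c + 1) = b1 * q + b1 * p + b1" "b2 * (c + 1) = b2 * q + b2 * p + b2"
    by (simp_all add: c algebra_simps)
  moreover have "0 < n" using n a by simp
  ultimately show ?thesis
    using a r T p1 p2 place_pos_last[OF a(1,2) n'] place_pos_last[OF a(1,3) n']
    unfolding symbol_delay_eq[OF \<open>0 < n\<close>] by linarith
qed

text \<open>Each capacity has the form \<open>x / (x + y)\<close> with \<open>y\<close> the burst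
  length, increasing in \<open>x\<close>, and the rate is its value at
  \<open>x = (c + 1) * y\<close>. So the rate is below both capacities, and one of them must attain
  it.\<close>

lemma rate_eq_capacity:
  fixes a1 a2 b1 b2 c T :: nat
  assumes a: "0 < a1" "0 < a2" "a1 \<le> b1" "a2 \<le> b2" "a = max a1 a2"
    and T: "T + 1 = b1 + b2 + a + c * max b1 b2" and ab: "a1 = a2 \<or> b1 = b2"
  shows "real (a * (c + 1)) / real (a * (c + 1) + a)
       = min (dcsw_capacity a1 b1 (real T - real b2)) (dcsw_capacity a2 b2 (real T - real b1))"
proof -
  have T': "real T = real b1 + real b2 + real a + real c * real (max b1 b2) - 1"
    using arg_cong[OF T, of real] by simp
  have rate: "real (a * (c + 1)) / real (a * (c + 1) + a) = (real c + 1) / (real c + 2)"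
  proof -
    have "real (a * (c + 1)) / real (a * (c + 1) + a) = (real a * (real c + 1)) / (real a * (real c + 2))"
      by (simp add: algebra_simps)
    then show ?thesis using a by simp
  qed
  have cap: "(real c + 1) / (real c + 2) \<le> x / (x + y)
           \<and> (x = (real c + 1) * y \<longrightarrow> (real c + 1) / (real c + 2) = x / (x + y))"
    if "0 < y" "(real c + 1) * y \<le> x" for x y :: real
  proof -
    have "0 < (real c + 1) * y" using that by simp
    with that have "0 < x" by linarith
    with that show ?thesis by (auto simp: field_simps)
  qed
  define x1 x2 where "x1 = real T - real b2 - real a1 + 1" and "x2 = real T - real b1 - real a2 + 1"
  have caps: "dcsw_capacity a1 b1 (real T - real b2) = x1 / (x1 + real b1)"
    "dcsw_capacity a2 b2 (real T - real b1) = x2 / (x2 + real b2)"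
    by (simp_all add: dcsw_capacity_def x1_def x2_def)
  have x: "x1 = real b1 + (real a - real a1) + real c * real (max b1 b2)"
    "x2 = real b2 + (real a - real a2) + real c * real (max b1 b2)"
    by (simp_all add: x1_def x2_def T')
  have le: "(real c + 1) * real b1 \<le> x1" "(real c + 1) * real b2 \<le> x2"
  proof -
    have "real c * real b1 \<le> real c * real (max b1 b2)" "real c * real b2 \<le> real c * real (max b1 b2)"
      by (auto intro: mult_left_mono)
    then show "(real c + 1) * real b1 \<le> x1" "(real c + 1) * real b2 \<le> x2"
      using a by (simp_all add: x algebra_simps)
  qed
  \<comment> \<open>If \<open>a1 = a2\<close>, the channel with the larger burst length attains the
    bound; if \<open>b1 = b2\<close>, the one with the larger \<open>a1\<close> or \<open>a2\<close>
    does.\<close>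
  have eq: "x1 = (real c + 1) * real b1 \<or> x2 = (real c + 1) * real b2"
    using ab a(5) unfolding x by (auto simp: max_def algebra_simps)
  have "0 < real b1" "0 < real b2" using a by auto
  with cap[OF _ le(1)] cap[OF _ le(2)] eq show ?thesis
    unfolding rate caps by (auto simp: min_def)
qed

theorem theorem2:
  fixes a1 b1 a2 b2 T a b1' b2' k n1 n2 :: nat
    and \<alpha> :: int
    and C1 C2 :: "'f::{field,finite} vec set"
  assumes "0 < a1" and "a1 \<le> b1" and "0 < a2" and "a2 \<le> b2" and "b1 + b2 \<le> T"
    and "a = max a1 a2" and "b1' = max b1 a" and "b2' = max b2 a"
    and "\<alpha> = int T + 1 - int b1' - int b2' - int a"
    and "int (max b1' b2') dvd \<alpha>"
    and "a1 = a2 \<or> b1 = b2"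
    and "k = nat \<lfloor>real a * ((real T - real (min b1' b2') - real a + 1) / real (max b1' b2'))\<rfloor>"
    and "n1 = k + a" and "n2 = k + a"
    and "systematic_mds_code n1 k C1" and "systematic_mds_code n2 k C2"
  shows "(\<exists>rel. streaming_code a1 b1 a2 b2 T k n1 n2
                  (source_encoder C1 a b1' n1 k) rel
                  (relay_packets C2 a b2' n2 k (symbol_delay a b1' n1)))
         \<and> real k / real (max n1 n2)
             = min (dcsw_capacity a1 b1 (T - b2)) (dcsw_capacity a2 b2 (T - b1))"
proof -
  \<comment> \<open>The alternative \<open>a1 = a2\<close> or \<open>b1 = b2\<close> is what bounds
    \<open>a\<close> by both burst lengths, so the primed parameters collapse.\<close>
  have ab: "0 < a" "a \<le> b1" "a \<le> b2" using assms(1-4,6,11) by auto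
  then have b': "b1' = b1" "b2' = b2" using assms(7,8) by auto
  let ?M = "max b1 b2"
  have M: "0 < ?M" "a \<le> ?M" using ab by auto
  obtain z where z: "\<alpha> = int ?M * z" using assms(10) unfolding b' by (auto elim: dvdE)
  \<comment> \<open>\<open>T \<ge> b\<^sub>1 + b\<^sub>2\<close> only gives \<open>\<alpha> > - a\<close>; divisibility excludes the negative values.\<close>
  have "- int ?M < \<alpha>" using assms(5,9) M unfolding b' by linarith
  then have "0 < int ?M * (z + 1)" unfolding z by (simp add: algebra_simps)
  then have "0 \<le> z" using M by (simp add: zero_less_mult_iff)
  then obtain c where c: "z = int c" using zero_le_imp_eq_int by blast
  have "int (T + 1) = int (b1 + b2 + a + c * ?M)"
    using z c assms(9) unfolding b' by (simp add: algebra_simps)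
  then have T: "T + 1 = b1 + b2 + a + c * ?M" by (simp only: of_nat_eq_iff)
  \<comment> \<open>By divisibility the quotient under the floor is the integer
    \<open>c + 1\<close>, so nothing is rounded away.\<close>
  have k: "k = a * (c + 1)"
  proof -
    have "real b1 + real b2 - real (min b1 b2) = real ?M" by (simp add: min_def max_def)
    moreover have "real T + 1 = real b1 + real b2 + real a + real c * real ?M"
      using arg_cong[OF T, of real] by simp
    ultimately have "real T - real (min b1 b2) - real a + 1 = (real c + 1) * real ?M"
      by (simp add: algebra_simps)
    then have "(real T - real (min b1 b2) - real a + 1) / real ?M = real c + 1"
      using M(1) by (simp only: nonzero_mult_div_cancel_right of_nat_eq_0_iff)
    then have "real a * ((real T - real (min b1 b2) - real a + 1) / real ?M) = real (a * (c + 1))"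
      by (simp add: algebra_simps)
    then show ?thesis unfolding assms(12) b' by (simp only: floor_of_nat nat_int)
  qed
  have n: "n1 = a * (c + 2)" using k assms(13) by simp
  have n12: "n2 = n1" using assms(13,14) by simp
  \<comment> \<open>For \<open>b = b1\<close> the right-hand side is exactly \<open>T - b2\<close>,
    and for \<open>b = b2\<close> exactly \<open>T - b1\<close>.\<close>
  have span: "place_pos a b (n1 - 1) \<le> b + (a - 1) + c * ?M" if "a \<le> b" "b \<le> ?M" for b
    using mult_le_mono1[OF that(2), of c] place_pos_last[OF ab(1) that(1) n]
    by (simp add: algebra_simps)
  have "\<exists>rel. streaming_code a1 b1 a2 b2 T k n1 n1 (source_encoder C1 a b1 n1 k) rel
                (relay_packets C2 a b2 n1 k (symbol_delay a b1 n1))"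
  proof (rule streaming_code_construction)
    show "place_pos a b1 (n1 - 1) \<le> T - b2" "place_pos a b2 (n1 - 1) \<le> T - b1"
      using span[OF ab(2)] span[OF ab(3)] T ab(1) by auto
    show "symbol_delay a b1 n1 j + symbol_delay a b2 n1 (k - 1 - j) \<le> int T" if "j < k" for j
      using ab k assms(13) T that by (rule total_delay_le)
  qed (use assms(1-6,13-16) ab n12 in simp_all)
  moreover have "real k / real (max n1 n1)
      = min (dcsw_capacity a1 b1 (real T - real b2)) (dcsw_capacity a2 b2 (real T - real b1))"
    using rate_eq_capacity[OF assms(1,3,2,4,6) T assms(11)] k assms(13) by simp
  ultimately show ?thesis using assms(5) unfolding b' n12 by (simp add: of_nat_diff)
qed

end
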